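(* Let $G=(V,E,w,\mu)$ be a weighted graph as in the context with $D_\mu<\infty$. Let $p>1$, $q\ge1$, and let $\psi:V\to[0,\infty)$ be bounded, not identically zero, with $\inf_{x\in V}\psi(x)>0$. For $\lambda>0$ let $u$ be a positive solution of $$u_t-\Delta u=u^p\,|\log u|^q\ \text{ in } V\times(0,T),\qquad u(x,0)=\lambda\psi(x)\ \text{ for } x\in V,$$ and let $T_\lambda$ be its lifespan. Let $\Omega\subset V$ be a nonempty finite connected set, let $\phi>0$ be the normalized first Dirichlet eigenfunction on $\Omega$, and assume $$\eta(0):=\int_\Omega u(\cdot,0)\,\phi\,d\mu=\sum_{x\in\Omega}\mu(x)\,\lambda\psi(x)\phi(x)\ \ge 1 .$$ Then there exists a constant $C=C(p,q,V)>0$ (depending only on $p$, $q$ and the weighted graph) such that $T_\lambda<\infty$ whenever $\lambda>\Lambda$, where $\Lambda>0$ satisfies $$\Lambda\cdot\inf_{x\in V}\psi(x)\ \ge\ \max\{C(p,q,V),\,1\}.$$ Furthermore, $$\lim_{\lambda\to+\infty}(\lambda\|\psi\|_\infty)^{p-1}\big(\log(\lambda\|\psi\|_\infty)\big)^{q}T_\lambda=\frac1{p-1}.$$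
   Context: Graph setting: $G=(V,E,w,\mu)$ is an infinite, locally finite, connected graph without loops or multiple edges, with edge weights $w_{xy}=w_{yx}>0$ for $xy\in E$ and vertex measure $\mu:V\to(0,\infty)$. Write $y\sim x$ if $xy\in E$. The Laplacian is $\Delta u(x)=\frac1{\mu(x)}\sum_{y\sim x}w_{xy}(u(y)-u(x))$, and $D_\mu:=\sup_{x\in V}\frac{1}{\mu(x)}\sum_{y\sim x}w_{xy}$. For $A\subset V$, $\int_A f\,d\mu=\sum_{x\in A}\mu(x)f(x)$. $\|\psi\|_\infty=\sup_{x\in V}|\psi(x)|$. Solutions: a (positive) solution on $[0,T)$ is a function $u$ on $V\times[0,T)$, positive on $V\times(0,T)$, such that for each $x\in V$, $u(x,\cdot)$ is continuous on $[0,T)$ and $C^1$ on $(0,T)$, the equation and initial condition hold, and $u\in L^\infty(V\times[0,T'])$ for every $0<T'<T$. The lifespan is $T_\lambda:=\sup\{T>0:\text{ the problem with initial datum }\lambda\psi\text{ admits a solution on }[0,T)\}$. Dirichlet eigenfunction: for finite $\Omega\subset V$, $\Delta_\Omega$ acts on functions $f$ on $\Omega$ by extending $f$ by zero to $V$, applying $\Delta$, and restricting to $\Omega$. For $\Omega$ nonempty, finite and connected, the smallest eigenvalue $\lambda_1(\Omega)>0$ of $-\Delta_\Omega$ is simple and has an eigenfunction $\phi>0$ on $\Omega$, normalized by $\sum_{x\in\Omega}\mu(x)\phi(x)=1$. *)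

theory Defs
  imports "HOL-Analysis.Analysis"
begin

record 'v wgraph =
  verts :: "'v set"
  edges :: "'v set set"
  weight :: "'v \<Rightarrow> 'v \<Rightarrow> real"
  vmeasure :: "'v \<Rightarrow> real"

definition nbrs :: "'v wgraph \<Rightarrow> 'v \<Rightarrow> 'v set" where
  "nbrs G x = {y. {x, y} \<in> edges G}"

definition connected_in :: "'v wgraph \<Rightarrow> 'v set \<Rightarrow> bool" where
  "connected_in G A \<longleftrightarrow>
     (\<forall>x\<in>A. \<forall>y\<in>A. (x, y) \<in> {(a, b). a \<in> A \<and> b \<in> A \<and> b \<in> nbrs G a}\<^sup>*)"

(* Edges are two-element vertex sets, which excludes loops and multiple edges.
   The values of the weight on non-edges are irrelevant. *)
locale weighted_graph =
  fixes G :: "'v wgraph"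
  assumes infinite_verts: "infinite (verts G)"
    and edges_pairs: "e \<in> edges G \<Longrightarrow> \<exists>x\<in>verts G. \<exists>y\<in>verts G. x \<noteq> y \<and> e = {x, y}"
    and locally_finite: "x \<in> verts G \<Longrightarrow> finite (nbrs G x)"
    and connected: "connected_in G (verts G)"
    and weight_sym: "{x, y} \<in> edges G \<Longrightarrow> weight G x y = weight G y x"
    and weight_pos: "{x, y} \<in> edges G \<Longrightarrow> weight G x y > 0"
    and vmeasure_pos: "x \<in> verts G \<Longrightarrow> vmeasure G x > 0"

definition laplacian :: "'v wgraph \<Rightarrow> ('v \<Rightarrow> real) \<Rightarrow> 'v \<Rightarrow> real" where
  "laplacian G f x = (1 / vmeasure G x) * (\<Sum>y\<in>nbrs G x. weight G x y * (f y - f x))"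

definition D_mu :: "'v wgraph \<Rightarrow> ereal" where
  "D_mu G = (SUP x\<in>verts G. ereal ((1 / vmeasure G x) * (\<Sum>y\<in>nbrs G x. weight G x y)))"

definition graph_integral :: "'v wgraph \<Rightarrow> 'v set \<Rightarrow> ('v \<Rightarrow> real) \<Rightarrow> real" where
  "graph_integral G A f = (\<Sum>x\<in>A. vmeasure G x * f x)"

definition sup_norm :: "'v wgraph \<Rightarrow> ('v \<Rightarrow> real) \<Rightarrow> real" where
  "sup_norm G f = (SUP x\<in>verts G. \<bar>f x\<bar>)"

(* A function on \<Omega> is represented by any total function; only its values on \<Omega> matter. *)
definition dirichlet_laplacian :: "'v wgraph \<Rightarrow> 'v set \<Rightarrow> ('v \<Rightarrow> real) \<Rightarrow> 'v \<Rightarrow> real" where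
  "dirichlet_laplacian G \<Omega> f x = laplacian G (\<lambda>y. if y \<in> \<Omega> then f y else 0) x"

definition dirichlet_eigenfunction ::
    "'v wgraph \<Rightarrow> 'v set \<Rightarrow> real \<Rightarrow> ('v \<Rightarrow> real) \<Rightarrow> bool" where
  "dirichlet_eigenfunction G \<Omega> \<kappa> f \<longleftrightarrow>
     (\<exists>x\<in>\<Omega>. f x \<noteq> 0) \<and> (\<forall>x\<in>\<Omega>. - dirichlet_laplacian G \<Omega> f x = \<kappa> * f x)"

definition lambda1 :: "'v wgraph \<Rightarrow> 'v set \<Rightarrow> real" where
  "lambda1 G \<Omega> = (LEAST \<kappa>. \<exists>f. dirichlet_eigenfunction G \<Omega> \<kappa> f)"

definition normalized_first_eigenfunction ::
    "'v wgraph \<Rightarrow> 'v set \<Rightarrow> ('v \<Rightarrow> real) \<Rightarrow> bool" where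
  "normalized_first_eigenfunction G \<Omega> \<phi> \<longleftrightarrow>
     dirichlet_eigenfunction G \<Omega> (lambda1 G \<Omega>) \<phi> \<and>
     (\<forall>x\<in>\<Omega>. \<phi> x > 0) \<and> graph_integral G \<Omega> \<phi> = 1"

(* Positive solutions on [0,T) with 0 < T \<le> \<infinity>; u x t is the value at vertex x and time t. *)
definition positive_solution ::
    "'v wgraph \<Rightarrow> real \<Rightarrow> real \<Rightarrow> ('v \<Rightarrow> real) \<Rightarrow> ereal \<Rightarrow> ('v \<Rightarrow> real \<Rightarrow> real) \<Rightarrow> bool" where
  "positive_solution G p q u0 T u \<longleftrightarrow>
     (\<forall>x\<in>verts G.
        continuous_on {t. 0 \<le> t \<and> ereal t < T} (u x) \<and>
        u x C1_differentiable_on {t. 0 < t \<and> ereal t < T} \<and>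
        (\<forall>t. 0 < t \<and> ereal t < T \<longrightarrow>
           u x t > 0 \<and>
           deriv (u x) t - laplacian G (\<lambda>y. u y t) x = u x t powr p * \<bar>ln (u x t)\<bar> powr q) \<and>
        u x 0 = u0 x) \<and>
     (\<forall>T'. 0 < T' \<and> ereal T' < T \<longrightarrow>
        bounded ((\<lambda>(x, t). u x t) ` (verts G \<times> {0..T'})))"

definition lifespan :: "'v wgraph \<Rightarrow> real \<Rightarrow> real \<Rightarrow> ('v \<Rightarrow> real) \<Rightarrow> ereal" where
  "lifespan G p q u0 = Sup {T. 0 < T \<and> (\<exists>u. positive_solution G p q u0 T u)}"

end

theory Submission
  imports Defs
begin

text \<open>
  Both bounds on the lifespan come from ordinary differential inequalities at large values.

  Let \<open>N = l * sup_norm G \<psi>\<close>. For the lower bound, \<open>ln z powr q \<le> ln N powr q * (z / N) powr e\<close> for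
  \<open>z \<ge> N\<close> and \<open>N\<close> large, so the explicit solution of
  \<open>z' = ln N powr q * N powr - e * z powr (p + e)\<close> with \<open>z 0 = N\<close> is a spatially constant
  supersolution. It exists up to time \<open>1 / ((p - 1 + e) * (N powr (p - 1) * ln N powr q))\<close>. The
  initial datum exceeds some \<open>a > 1\<close>, and the nonlinearity is increasing on \<open>[a, \<infinity>)\<close>, so iterating
  the Duhamel formula (with the diagonal part of the Laplacian as integrating factor) from the
  constant \<open>a\<close> gives an increasing sequence below \<open>z\<close> whose limit is a solution.

  For the upper bound, at a single vertex \<open>x\<close> the Laplacian of a positive
  function is at least \<open>- D * u x t\<close>, so for large data \<open>u x\<close> blows up not later than an ordinary
  differential inequality does, and \<open>\<psi> x\<close> may be taken as close to \<open>sup_norm G \<psi>\<close> as desired.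
\<close>

section \<open>The diagonal part of the Laplacian and scalar estimates\<close>

definition weighted_degree :: "'v wgraph \<Rightarrow> 'v \<Rightarrow> real" where
  "weighted_degree G x = (\<Sum>y\<in>nbrs G x. weight G x y) / vmeasure G x"

text \<open>Variation of constants with only the diagonal part of the Laplacian moved into the
  exponential: the remaining neighbour weights are positive, so the integrand is monotone in
  \<open>u\<close> wherever \<open>f\<close> is monotone.\<close>

definition duhamel ::
    "'v wgraph \<Rightarrow> (real \<Rightarrow> real) \<Rightarrow> ('v \<Rightarrow> real) \<Rightarrow> ('v \<Rightarrow> real \<Rightarrow> real) \<Rightarrow> 'v \<Rightarrow> real \<Rightarrow> real" where
  "duhamel G f u0 u x t = exp (- weighted_degree G x * t) *
     (u0 x + integral {0..t} (\<lambda>s. exp (weighted_degree G x * s) *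
        ((\<Sum>y\<in>nbrs G x. weight G x y * u y s) / vmeasure G x + f (u x s))))"

lemma laplacian_eq:
  "laplacian G f x =
     (\<Sum>y\<in>nbrs G x. weight G x y * f y) / vmeasure G x - weighted_degree G x * f x"
  by (simp add: laplacian_def weighted_degree_def right_diff_distrib sum_subtractf
      diff_divide_distrib sum_distrib_right)

text \<open>The integrand is the derivative of \<open>exp (d * s) * z s\<close>. This puts a
  spatially constant barrier into the same integral form as \<open>duhamel\<close>, so that barriers
  and iterates can be compared under the integral.\<close>

lemma has_integral_exp_mult:
  fixes z z' :: "real \<Rightarrow> real"
  assumes "0 \<le> t"
    and "\<And>s. s \<in> {0..t} \<Longrightarrow> (z has_real_derivative z' s) (at s within {0..t})"
  shows "((\<lambda>s. exp (d * s) * (d * z s + z' s)) has_integral exp (d * t) * z t - z 0) {0..t}"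
proof -
  have "((\<lambda>s. exp (d * s) * (d * z s + z' s)) has_integral
      exp (d * t) * z t - exp (d * 0) * z 0) {0..t}"
    by (rule fundamental_theorem_of_calculus)
      (use assms in \<open>auto intro!: derivative_eq_intros
        simp flip: has_real_derivative_iff_has_vector_derivative simp: algebra_simps\<close>)
  then show ?thesis by simp
qed

text \<open>Above \<open>exp (q / e)\<close> the function \<open>ln s powr q / s powr e\<close> is decreasing.\<close>
lemma ln_powr_le:
  fixes q e N s :: real
  assumes "q > 0" "e > 0" "N \<ge> exp (q / e)" "s \<ge> N"
  shows "ln s powr q \<le> ln N powr q * (s / N) powr e"
proof -
  have N: "N > 1" "ln N \<ge> q / e"
  proof -
    show "ln N \<ge> q / e" using assms(3) ln_ge_iff[of N "q / e"] by (meson exp_gt_zero less_le_trans)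
    show "N > 1" using assms(1-3) by (metis divide_pos_pos less_le_trans one_less_exp_iff)
  qed
  define r where "r = ln s - ln N"
  have r: "r \<ge> 0" using N assms by (simp add: r_def)
  have lN: "ln N > 0" using N by simp
  \<comment> \<open>Since \<open>r = ln (s / N)\<close>, the bound \<open>ln N \<ge> q / e\<close>
    turns \<open>1 + y \<le> exp y\<close> at \<open>y = r * e / q\<close> into
    \<open>ln s \<le> ln N * (s / N) powr (e / q)\<close>.\<close>
  have "r / ln N \<le> r / (q / e)"
    using N assms r by (intro divide_left_mono) (auto simp: mult_pos_pos)
  then have "1 + r / ln N \<le> exp (r * e / q)"
    using exp_ge_add_one_self[of "r * e / q"] by (simp del: exp_ge_add_one_self)
  then have "ln N * (1 + r / ln N) \<le> ln N * exp (r * e / q)"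
    using lN by (intro mult_left_mono) auto
  then have "ln s \<le> ln N * exp (r * e / q)"
    using lN by (simp add: r_def field_simps)
  then have "ln s powr q \<le> (ln N * exp (r * e / q)) powr q"
    using assms N by (intro powr_mono2) auto
  also have "\<dots> = ln N powr q * exp (r * e)"
    using lN assms by (simp add: powr_mult exp_powr_real)
  also have "exp (r * e) = (s / N) powr e"
    using N assms by (simp add: powr_def r_def ln_div mult.commute)
  finally show ?thesis .
qed

lemma weighted_degree_bounded:
  assumes "D_mu G < \<infinity>"
  shows "\<exists>D\<ge>0. \<forall>x\<in>verts G. weighted_degree G x \<le> D"
proof -
  have "\<exists>D. D_mu G \<le> ereal D"
    using assms by (cases "D_mu G") auto
  then obtain D where D: "D_mu G \<le> ereal D" by blast
  have "weighted_degree G x \<le> max D 0" if "x \<in> verts G" for x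
  proof -
    have "ereal (weighted_degree G x) \<le> D_mu G"
      unfolding D_mu_def weighted_degree_def using that by (auto intro!: SUP_upper2[of x])
    then show ?thesis using D by (metis ereal_less_eq(3) le_max_iff_disj order_trans)
  qed
  then show ?thesis by (intro exI[of _ "max D 0"]) auto
qed

text \<open>The quantity is the blow-up bound of \<open>solution_time_le\<close> for initial value
  \<open>y\<close>, which must fall inside the window \<open>\<tau>\<close>. For large
  \<open>y\<close> it does: \<open>y powr (1 - p)\<close> tends to 0, and the logarithmic factor is
  at least 1 once \<open>ln y \<ge> D * \<tau> + 1\<close>.\<close>

lemma eventually_lifespan_bound_small:
  fixes p q D \<tau> :: real
  assumes p: "p > 1" and q: "q \<ge> 0" and \<tau>: "\<tau> > 0"
  shows "eventually (\<lambda>y. y > 1 \<and> ln y > D * \<tau> \<and>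
    y powr (1 - p) * exp ((p - 1) * D * \<tau>) / ((p - 1) * (ln y - D * \<tau>) powr q) < \<tau>) at_top"
proof -
  let ?c = "exp ((p - 1) * D * \<tau>) / (p - 1)"
  have "((\<lambda>y. y powr (1 - p) * ?c) \<longlongrightarrow> 0 * ?c) at_top"
    using p by (intro tendsto_intros tendsto_neg_powr filterlim_ident) auto
  then have "eventually (\<lambda>y. y powr (1 - p) * ?c < \<tau>) at_top"
    using \<tau> by (intro order_tendstoD) auto
  moreover have "eventually (\<lambda>y::real. ln y \<ge> D * \<tau> + 1) at_top"
    using ln_at_top by (simp add: filterlim_at_top)
  ultimately show ?thesis
    using eventually_gt_at_top[of "1::real"]
  proof eventually_elim
    case (elim y)
    have "1 \<le> (ln y - D * \<tau>) powr q"
      using elim q by (intro ge_one_powr_ge_zero) auto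
    then have "y powr (1 - p) * ?c / (ln y - D * \<tau>) powr q \<le> y powr (1 - p) * ?c / 1"
      using p by (intro divide_left_mono) auto
    then show ?case using elim by (simp add: mult.assoc)
  qed
qed

section \<open>Neighbours, positivity and weighted averages\<close>

context weighted_graph
begin

lemma nbrs_verts: "y \<in> nbrs G x \<Longrightarrow> y \<in> verts G"
  using edges_pairs[of "{x, y}"] by (auto simp: nbrs_def doubleton_eq_iff)

lemma weight_nbrs_pos: "y \<in> nbrs G x \<Longrightarrow> weight G x y > 0"
  using weight_pos by (simp add: nbrs_def)

lemma weighted_degree_nonneg: "x \<in> verts G \<Longrightarrow> weighted_degree G x \<ge> 0"
  unfolding weighted_degree_def
  using vmeasure_pos[of x] weight_nbrs_pos
  by (intro divide_nonneg_nonneg sum_nonneg) (auto intro: less_imp_le)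

lemma average_mono:
  assumes "x \<in> verts G" and "\<And>y. y \<in> verts G \<Longrightarrow> g y \<le> h y"
  shows "(\<Sum>y\<in>nbrs G x. weight G x y * g y) / vmeasure G x
       \<le> (\<Sum>y\<in>nbrs G x. weight G x y * h y) / vmeasure G x"
  using assms vmeasure_pos[of x] weight_nbrs_pos nbrs_verts
  by (intro divide_right_mono sum_mono mult_left_mono) (auto intro: less_imp_le)

lemma average_const:
  "(\<Sum>y\<in>nbrs G x. weight G x y * c) / vmeasure G x = weighted_degree G x * c"
  by (simp add: weighted_degree_def sum_distrib_right)

section \<open>Existence by monotone iteration and the lower bound on the lifespan\<close>

text \<open>The Duhamel map is monotone when \<open>f\<close> is, so iterating it from the subsolution \<open>a\<close>
  produces an increasing sequence that stays below the supersolution \<open>z\<close>.\<close>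
lemma monotone_iteration:
  fixes f z z' :: "real \<Rightarrow> real" and u0 :: "'v \<Rightarrow> real"
  assumes f_cont: "continuous_on {a..} f"
    and f_mono: "\<And>r s. a \<le> r \<Longrightarrow> r \<le> s \<Longrightarrow> f r \<le> f s"
    and a_nonneg: "a \<ge> 0"
    and f_nonneg: "f a \<ge> 0"
    and u0: "\<And>x. x \<in> verts G \<Longrightarrow> a \<le> u0 x \<and> u0 x \<le> z 0"
    and z_deriv: "\<And>t. 0 \<le> t \<Longrightarrow> t < T \<Longrightarrow> (z has_real_derivative z' t) (at t)"
    and z_super: "\<And>t. 0 \<le> t \<Longrightarrow> t < T \<Longrightarrow> f (z t) \<le> z' t"
    and z_ge: "\<And>t. 0 \<le> t \<Longrightarrow> t < T \<Longrightarrow> a \<le> z t"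
  shows "\<exists>u. \<forall>x\<in>verts G. \<forall>t. 0 \<le> t \<and> t < T \<longrightarrow>
           a \<le> u x t \<and> u x t \<le> z t \<and> u x t = duhamel G f u0 u x t \<and>
           continuous_on {0..t} (u x)"
proof -
  define h where "h u x s = exp (weighted_degree G x * s) *
        ((\<Sum>y\<in>nbrs G x. weight G x y * u y s) / vmeasure G x + f (u x s))"
    for u :: "'v \<Rightarrow> real \<Rightarrow> real" and x s
  have duhamel_h: "duhamel G f u0 u x t =
      exp (- weighted_degree G x * t) * (u0 x + integral {0..t} (h u x))" for u x t
    by (simp add: duhamel_def h_def[abs_def])
  define \<Phi> where "\<Phi> = duhamel G f u0"
  \<comment> \<open>The invariant class of the iteration: values above \<open>a\<close> stay where
    \<open>f\<close> is continuous and monotone, and continuity in time makes the Duhamel integrand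
    integrable.\<close>
  define good where "good u \<longleftrightarrow> (\<forall>x\<in>verts G. \<forall>t. 0 \<le> t \<and> t < T \<longrightarrow>
      a \<le> u x t \<and> u x t \<le> z t \<and> continuous_on {0..t} (u x))" for u :: "'v \<Rightarrow> real \<Rightarrow> real"
  define le where "le u v \<longleftrightarrow> (\<forall>x\<in>verts G. \<forall>t. 0 \<le> t \<and> t < T \<longrightarrow> u x t \<le> v x t)"
    for u v :: "'v \<Rightarrow> real \<Rightarrow> real"
  have z_within: "(z has_real_derivative z' s) (at s within {0..t})"
    if "s \<in> {0..t}" "t < T" for s t
    using z_deriv[of s] that has_field_derivative_at_within by auto
  have h_mono: "h u x s \<le> h v x s"
    if "x \<in> verts G" "0 \<le> s" "s < T" "\<And>y. y \<in> verts G \<Longrightarrow> a \<le> u y s \<and> u y s \<le> v y s" for u v x s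
    unfolding h_def using that
    by (intro mult_left_mono add_mono average_mono f_mono) auto
  have h_cont: "continuous_on {0..t} (h u x)"
    if "x \<in> verts G" "\<And>y. y \<in> verts G \<Longrightarrow> continuous_on {0..t} (u y)"
      "\<And>s. s \<in> {0..t} \<Longrightarrow> a \<le> u x s" for u x t
  proof -
    have "continuous_on {0..t} (\<lambda>s. f (u x s))"
      by (rule continuous_on_compose2[OF f_cont]) (use that in auto)
    then show ?thesis
      unfolding h_def using vmeasure_pos[OF that(1)] that nbrs_verts
      by (auto intro!: continuous_intros)
  qed
  have duhamel_cont: "continuous_on {0..t} (\<Phi> u x)"
    if "h u x integrable_on {0..t}" for u x t
    unfolding \<Phi>_def duhamel_h
    by (intro continuous_intros indefinite_integral_continuous_1 that)
  have h_z: "(\<lambda>s. exp (weighted_degree G x * s) * (weighted_degree G x * z s + z' s))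
      integrable_on {0..t}" (is ?A)
    and h_z_integral: "integral {0..t}
      (\<lambda>s. exp (weighted_degree G x * s) * (weighted_degree G x * z s + z' s)) =
        exp (weighted_degree G x * t) * z t - z 0" (is ?B)
    if "0 \<le> t" "t < T" for x t
    using has_integral_exp_mult[of t z z' "weighted_degree G x"] z_within[of _ t] that
    by (auto simp: has_integral_integrable integral_unique)
  \<comment> \<open>The upper bound has a known integral by \<open>h_z_integral\<close>. It serves
    twice: to keep the iterates below \<open>z\<close>, and as the dominating function in the
    passage to the limit.\<close>
  have h_nonneg_le: "h (\<lambda>_ _. a) x s \<le> h u x s \<and>
      h u x s \<le> exp (weighted_degree G x * s) * (weighted_degree G x * z s + z' s)"
    if "x \<in> verts G" "0 \<le> s" "s < T" "\<And>y. y \<in> verts G \<Longrightarrow> a \<le> u y s \<and> u y s \<le> z s" for u x s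
  proof -
    have "h u x s \<le> h (\<lambda>_. z) x s" "h (\<lambda>_ _. a) x s \<le> h u x s"
      using that by (auto intro!: h_mono)
    moreover have "h (\<lambda>_. z) x s \<le>
        exp (weighted_degree G x * s) * (weighted_degree G x * z s + z' s)"
      unfolding h_def average_const using z_super[of s] that by simp
    ultimately show ?thesis by simp
  qed
  have goodD: "good u \<Longrightarrow> x \<in> verts G \<Longrightarrow> 0 \<le> t \<Longrightarrow> t < T \<Longrightarrow> h u x integrable_on {0..t}" for u x t
    unfolding good_def
    by (intro integrable_continuous_real h_cont) (auto intro: order.strict_trans1)
  have duhamel_le_z: "\<Phi> u x t \<le> z t" if "good u" "x \<in> verts G" "0 \<le> t" "t < T" for u x t
  proof -
    have "integral {0..t} (h u x) \<le> exp (weighted_degree G x * t) * z t - z 0"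
      unfolding h_z_integral[OF that(3,4), of x, symmetric]
      using that goodD[OF that] h_z[OF that(3,4)] h_nonneg_le[of x _ u]
      by (intro integral_le) (auto simp: good_def)
    then have "u0 x + integral {0..t} (h u x) \<le> exp (weighted_degree G x * t) * z t"
      using u0[OF that(2)] by simp
    then have "\<Phi> u x t \<le>
        exp (- weighted_degree G x * t) * (exp (weighted_degree G x * t) * z t)"
      unfolding \<Phi>_def duhamel_h by (intro mult_left_mono) auto
    then show ?thesis by (simp flip: exp_add mult.assoc)
  qed
  have duhamel_ge_a: "a \<le> \<Phi> u x t" if "good u" "x \<in> verts G" "0 \<le> t" "t < T" for u x t
  proof -
    \<comment> \<open>The constant \<open>a\<close> is treated as a barrier with derivative 0, hence
      the \<open>+ 0\<close>. Its neighbour average balances the diagonal term, so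
      \<open>f a \<ge> 0\<close> makes it a subsolution.\<close>
    have I: "((\<lambda>s. exp (weighted_degree G x * s) * (weighted_degree G x * a + 0))
        has_integral exp (weighted_degree G x * t) * a - a) {0..t}"
      using that by (intro has_integral_exp_mult) auto
    have "exp (weighted_degree G x * s) * (weighted_degree G x * a + 0) \<le> h u x s"
      if "s \<in> {0..t}" for s
    proof -
      have "exp (weighted_degree G x * s) * (weighted_degree G x * a + 0) \<le> h (\<lambda>_ _. a) x s"
        unfolding h_def average_const using f_nonneg by simp
      also have "\<dots> \<le> h u x s"
        using h_nonneg_le[of x s u] \<open>good u\<close> \<open>x \<in> verts G\<close> \<open>t < T\<close> that by (auto simp: good_def)
      finally show ?thesis .
    qed
    then have "exp (weighted_degree G x * t) * a - a \<le> integral {0..t} (h u x)"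
      using I goodD[OF that] by (auto intro!: has_integral_le[OF I] integrable_integral)
    then have "exp (weighted_degree G x * t) * a \<le> u0 x + integral {0..t} (h u x)"
      using u0[OF that(2)] by simp
    then have "exp (- weighted_degree G x * t) * (exp (weighted_degree G x * t) * a) \<le> \<Phi> u x t"
      unfolding \<Phi>_def duhamel_h by (intro mult_left_mono) auto
    then show ?thesis by (simp flip: exp_add mult.assoc)
  qed
  have good_duhamel: "good (\<Phi> u)" if "good u" for u
    using duhamel_ge_a duhamel_le_z duhamel_cont goodD that unfolding good_def by blast
  have duhamel_mono: "le (\<Phi> u) (\<Phi> v)" if "good u" "good v" "le u v" for u v
    unfolding le_def
  proof (intro ballI allI impI)
    fix x t assume x: "x \<in> verts G" and t: "0 \<le> t \<and> t < T"
    have "integral {0..t} (h u x) \<le> integral {0..t} (h v x)"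
      using that x t by (intro integral_le goodD h_mono) (auto simp: good_def le_def)
    then show "\<Phi> u x t \<le> \<Phi> v x t" unfolding \<Phi>_def duhamel_h by simp
  qed
  define U where "U n = (\<Phi> ^^ n) (\<lambda>_ _. a)" for n
  have U_good: "good (U n)" for n
  proof (induction n)
    case 0
    then show ?case unfolding U_def good_def using z_ge by simp
  next
    case (Suc n)
    then show ?case using good_duhamel by (simp add: U_def)
  qed
  have U_le: "le (U n) (U (Suc n))" for n
  proof (induction n)
    case 0
    show ?case using duhamel_ge_a[OF U_good[of 0]] by (simp add: U_def le_def)
  next
    case (Suc n)
    then show ?case using duhamel_mono[OF U_good U_good, of n "Suc n"] by (simp add: U_def)
  qed
  define u where "u x t = lim (\<lambda>n. U n x t)" for x t
  have U_lim: "(\<lambda>n. U n x t) \<longlonglongrightarrow> u x t" if "x \<in> verts G" "0 \<le> t" "t < T" for x t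
  proof -
    have "incseq (\<lambda>n. U n x t)"
      using U_le that by (intro incseq_SucI) (auto simp: le_def)
    moreover have "U n x t \<le> z t" for n
      using U_good that by (auto simp: good_def)
    ultimately have "convergent (\<lambda>n. U n x t)"
      using incseq_convergent unfolding convergent_def by metis
    then show ?thesis by (simp add: u_def convergent_LIMSEQ_iff)
  qed
  have u_bounds: "a \<le> u x t \<and> u x t \<le> z t" if "x \<in> verts G" "0 \<le> t" "t < T" for x t
    using U_good that
    by (auto intro!: LIMSEQ_le_const[OF U_lim] LIMSEQ_le_const2[OF U_lim] simp: good_def)
  have h_lim: "(\<lambda>n. h (U n) x s) \<longlonglongrightarrow> h u x s" if "x \<in> verts G" "0 \<le> s" "s < T" for x s
  proof -
    have "(\<lambda>n. f (U n x s)) \<longlonglongrightarrow> f (u x s)"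
      by (rule continuous_on_tendsto_compose[OF f_cont U_lim])
        (use that u_bounds U_good in \<open>auto simp: good_def\<close>)
    then show ?thesis
      unfolding h_def using that vmeasure_pos[of x] nbrs_verts
      by (intro tendsto_intros U_lim) auto
  qed
  have h_int: "h u x integrable_on {0..t}"
    and h_int_lim: "(\<lambda>n. integral {0..t} (h (U n) x)) \<longlonglongrightarrow> integral {0..t} (h u x)"
    if "x \<in> verts G" "0 \<le> t" "t < T" for x t
  proof -
    \<comment> \<open>The integrand at the constant \<open>a\<close> is nonnegative, so the
      one-sided estimates already bound the norm.\<close>
    have bound: "norm (h (U n) x s) \<le>
        exp (weighted_degree G x * s) * (weighted_degree G x * z s + z' s)" if "s \<in> {0..t}" for n s
    proof -
      have "0 \<le> h (\<lambda>_ _. a) x s"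
        unfolding h_def average_const
        using f_nonneg a_nonneg weighted_degree_nonneg[OF \<open>x \<in> verts G\<close>] by simp
      then show ?thesis
        using h_nonneg_le[of x s "U n"] U_good[of n] \<open>x \<in> verts G\<close> \<open>t < T\<close> that
        by (auto simp: good_def)
    qed
    show "h u x integrable_on {0..t}"
      "(\<lambda>n. integral {0..t} (h (U n) x)) \<longlonglongrightarrow> integral {0..t} (h u x)"
      using dominated_convergence[of "\<lambda>n. h (U n) x" "{0..t}" _ "h u x",
          OF _ h_z[OF that(2,3)] bound] goodD[OF U_good that] h_lim that by auto
  qed
  have u_fix: "u x t = \<Phi> u x t" if "x \<in> verts G" "0 \<le> t" "t < T" for x t
  proof (rule LIMSEQ_unique)
    show "(\<lambda>n. U (Suc n) x t) \<longlonglongrightarrow> u x t"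
      using U_lim[OF that] by (rule LIMSEQ_Suc)
    have "(\<lambda>n. \<Phi> (U n) x t) \<longlonglongrightarrow> \<Phi> u x t"
      unfolding \<Phi>_def duhamel_h by (intro tendsto_intros h_int_lim that)
    then show "(\<lambda>n. U (Suc n) x t) \<longlonglongrightarrow> \<Phi> u x t" by (simp add: U_def)
  qed
  \<comment> \<open>A monotone limit of continuous functions need not be continuous; continuity
    comes from the fixed-point identity, whose right-hand side contains \<open>u\<close> only under
    an indefinite integral.\<close>
  have u_cont: "continuous_on {0..t} (u x)" if "x \<in> verts G" "0 \<le> t" "t < T" for x t
    using duhamel_cont[OF h_int[OF that]]
    by (rule continuous_on_eq) (use u_fix that in auto)
  show ?thesis
    using u_bounds u_fix u_cont unfolding \<Phi>_def by blast
qed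

text \<open>Continuity of \<open>u\<close> makes the Duhamel integrand continuous, so
  differentiating the fixed-point identity returns the equation. The bound
  \<open>u \<ge> a > 1\<close> keeps the logarithm positive and hence the nonlinearity continuous in
  time; \<open>z\<close> bounds \<open>u\<close> uniformly over the infinite vertex set.\<close>

lemma solution_of_duhamel_fixpoint:
  fixes u :: "'v \<Rightarrow> real \<Rightarrow> real"
  assumes p: "p \<ge> 0" and a: "a > 1" and T: "T > 0"
    and u: "\<And>x t. x \<in> verts G \<Longrightarrow> 0 \<le> t \<Longrightarrow> t < T \<Longrightarrow>
           a \<le> u x t \<and> u x t \<le> z t \<and>
           u x t = duhamel G (\<lambda>s. s powr p * \<bar>ln s\<bar> powr q) u0 u x t \<and>
           continuous_on {0..t} (u x)"
    and z_cont: "\<And>t. 0 \<le> t \<Longrightarrow> t < T \<Longrightarrow> isCont z t"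
  shows "positive_solution G p q u0 (ereal T) u"
proof -
  define f where "f s = s powr p * \<bar>ln s\<bar> powr q" for s :: real
  define h where "h x s = exp (weighted_degree G x * s) *
        ((\<Sum>y\<in>nbrs G x. weight G x y * u y s) / vmeasure G x + f (u x s))" for x s
  have u_eq: "u x t = exp (- weighted_degree G x * t) * (u0 x + integral {0..t} (h x))"
    if "x \<in> verts G" "0 \<le> t" "t < T" for x t
    using u[OF that] by (simp add: duhamel_def h_def[abs_def] f_def)
  have h_cont: "continuous_on {0..b} (h x)" if "x \<in> verts G" "0 \<le> b" "b < T" for x b
  proof -
    have "u x s \<ge> a" if "s \<in> {0..b}" for s
      using u[of x s] \<open>x \<in> verts G\<close> \<open>b < T\<close> that by simp
    then show ?thesis
      unfolding h_def f_def using u that vmeasure_pos[of x] nbrs_verts a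
      by (auto intro!: continuous_intros) force+
  qed
  have u_deriv: "(u x has_real_derivative laplacian G (\<lambda>y. u y t) x + f (u x t)) (at t)"
    if "x \<in> verts G" "0 < t" "t < T" for x t
  proof -
    \<comment> \<open>With \<open>b\<close> strictly between \<open>t\<close> and \<open>T\<close>,
      the point \<open>t\<close> is interior to \<open>{0..b}\<close>, and the derivative within
      that interval is a full derivative.\<close>
    define b where "b = (t + T) / 2"
    have b: "t < b" "b < T" using that by (auto simp: b_def)
    let ?d = "weighted_degree G x"
    have "((\<lambda>r. integral {0..r} (h x)) has_real_derivative h x t) (at t within {0..b})"
      by (rule integral_has_real_derivative[OF h_cont]) (use that b in auto)
    then have "((\<lambda>r. integral {0..r} (h x)) has_real_derivative h x t) (at t)"
      using at_within_Icc_at[of 0 t b] that b by simp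
    then have "((\<lambda>r. exp (- ?d * r) * (u0 x + integral {0..r} (h x))) has_real_derivative
        - ?d * (exp (- ?d * t) * (u0 x + integral {0..t} (h x))) + exp (- ?d * t) * h x t) (at t)"
      by (auto intro!: derivative_eq_intros simp: algebra_simps)
    moreover have "- ?d * (exp (- ?d * t) * (u0 x + integral {0..t} (h x))) + exp (- ?d * t) * h x t
        = laplacian G (\<lambda>y. u y t) x + f (u x t)"
    proof -
      have "exp (- ?d * t) * h x t =
          (\<Sum>y\<in>nbrs G x. weight G x y * u y t) / vmeasure G x + f (u x t)"
        by (simp add: h_def flip: exp_add mult.assoc)
      then show ?thesis
        using u_eq[OF that(1), of t] that by (simp add: laplacian_eq)
    qed
    ultimately have "((\<lambda>r. exp (- ?d * r) * (u0 x + integral {0..r} (h x))) has_real_derivative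
        laplacian G (\<lambda>y. u y t) x + f (u x t)) (at t)" by simp
    \<comment> \<open>The fixed-point identity is available only on \<open>[0, T)\<close>, so the
      derivative is transferred on an open interval containing \<open>t\<close>.\<close>
    then show ?thesis
      by (rule has_field_derivative_transform_within_open[where S = "{0<..<T}"]) (use that u_eq in auto)
  qed
  have u_cont: "continuous_on {0..<T} (u x)" if "x \<in> verts G" for x
    unfolding continuous_on_eq_continuous_within
  proof
    fix t assume t: "t \<in> {0..<T}"
    define b where "b = (t + T) / 2"
    have b: "t < b" "b < T" using t by (auto simp: b_def)
    have "at t within {0..<T} = at t within {0..b}"
      by (rule at_within_nhd[of _ "{..<b}"]) (use t b in auto)
    moreover have "continuous (at t within {0..b}) (u x)"
      using u[OF that, of b] t b by (auto simp: continuous_on_eq_continuous_within)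
    ultimately show "continuous (at t within {0..<T}) (u x)" by simp
  qed
  have u_C1: "u x C1_differentiable_on {0<..<T}" if "x \<in> verts G" for x
    unfolding C1_differentiable_on_def
  proof (intro exI conjI ballI)
    show "(u x has_vector_derivative laplacian G (\<lambda>y. u y t) x + f (u x t)) (at t)"
      if "t \<in> {0<..<T}" for t
      using u_deriv[OF \<open>x \<in> verts G\<close>] that
      by (simp flip: has_real_derivative_iff_has_vector_derivative)
    have c: "continuous_on {0<..<T} (u y)" if "y \<in> verts G" for y
      by (rule continuous_on_subset[OF u_cont[OF that]]) auto
    have "u x s \<ge> a" if "s \<in> {0<..<T}" for s
      using u[of x s] \<open>x \<in> verts G\<close> that by simp
    then show "continuous_on {0<..<T} (\<lambda>t. laplacian G (\<lambda>y. u y t) x + f (u x t))"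
      unfolding laplacian_def f_def using c that vmeasure_pos[of x] nbrs_verts a
      by (auto intro!: continuous_intros) force+
  qed
  have u_bounded: "bounded ((\<lambda>(x, t). u x t) ` (verts G \<times> {0..b}))" if "0 < b" "b < T" for b
  proof -
    have "continuous_on {0..b} z"
      using z_cont that by (intro continuous_at_imp_continuous_on) auto
    then have "bounded (z ` {0..b})"
      by (intro compact_imp_bounded compact_continuous_image) auto
    then obtain B where B: "\<And>t. t \<in> {0..b} \<Longrightarrow> \<bar>z t\<bar> \<le> B"
      unfolding bounded_iff by force
    have "\<bar>u x t\<bar> \<le> B" if "x \<in> verts G" "t \<in> {0..b}" for x t
      using u[OF that(1), of t] that(2) \<open>b < T\<close> B[OF that(2)] a by auto
    then show ?thesis unfolding bounded_iff by force
  qed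
  have sets: "{t. 0 \<le> t \<and> ereal t < ereal T} = {0..<T}" "{t. 0 < t \<and> ereal t < ereal T} = {0<..<T}"
    by auto
  have u_pos: "u x t > 0" if "x \<in> verts G" "0 < t" "t < T" for x t
    using u[OF that(1), of t] that a by auto
  have u_init: "u x 0 = u0 x" if "x \<in> verts G" for x
    using u_eq[OF that, of 0] T by simp
  show ?thesis
    unfolding positive_solution_def sets
    using u_cont u_C1 u_bounded u_pos u_init DERIV_imp_deriv[OF u_deriv]
    by (auto simp: f_def)
qed

text \<open>The bound is the existence time of the explicit supersolution that
  \<open>ln_powr_le\<close> makes possible. The loss \<open>e\<close> in the exponent can later be
  made arbitrarily small.\<close>

lemma lifespan_ge:
  assumes "p > 1" "q > 0" "e > 0" "a > 1" "N \<ge> exp (q / e)"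
    and u0: "\<And>x. x \<in> verts G \<Longrightarrow> a \<le> u0 x \<and> u0 x \<le> N"
  shows "ereal (1 / ((p - 1 + e) * (N powr (p - 1) * ln N powr q))) \<le> lifespan G p q u0"
proof -
  define f where "f s = s powr p * \<bar>ln s\<bar> powr q" for s :: real
  define r where "r = p - 1 + e"
  define K where "K = ln N powr q * N powr - e"
  define T where "T = 1 / (r * (N powr (p - 1) * ln N powr q))"
  \<comment> \<open>Separation of variables in \<open>z' = K * z powr (r + 1)\<close>,
    \<open>z 0 = N\<close>: the function \<open>z powr - r\<close> falls linearly with slope
    \<open>r * K\<close> and would reach 0 exactly at \<open>T\<close>.\<close>
  define z where "z t = (N powr - r - r * K * t) powr (- 1 / r)" for t
  have N: "N > 1" using assms(2,3,5) by (metis divide_pos_pos less_le_trans one_less_exp_iff)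
  have r: "r > 0" using assms by (simp add: r_def)
  have K: "K > 0" using N by (simp add: K_def)
  have T: "T > 0" using N r by (simp add: T_def)
  have TK: "r * K * T = N powr - r"
  proof -
    have "N powr - e = N powr - r * N powr (p - 1)"
      by (simp add: r_def flip: powr_add)
    then show ?thesis using N r by (simp add: T_def K_def)
  qed
  have pos: "N powr - r - r * K * t > 0" if "t < T" for t
    using that r K by (simp flip: TK)
  have z_N: "N \<le> z t" if "0 \<le> t" "t < T" for t
  proof -
    have "N = (N powr - r) powr (- 1 / r)" using N r by (simp add: powr_powr)
    also have "\<dots> \<le> z t"
      unfolding z_def using pos[OF that(2)] that r K by (intro powr_mono2') auto
    finally show ?thesis .
  qed
  have z_deriv: "(z has_real_derivative K * z t powr (r + 1)) (at t)" if "t < T" for t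
  proof -
    have "(z has_real_derivative
        (- 1 / r) * (N powr - r - r * K * t) powr (- 1 / r - 1) * (- (r * K))) (at t)"
      unfolding z_def using pos[OF that]
      by (auto intro!: derivative_eq_intros simp: powr_diff)
    moreover have "- 1 / r - 1 = (- 1 / r) * (r + 1)"
      using r by (simp add: field_simps)
    then have "(N powr - r - r * K * t) powr (- 1 / r - 1) = z t powr (r + 1)"
      by (simp only: z_def powr_powr)
    ultimately show ?thesis using r by (simp add: field_simps)
  qed
  have z_super: "f (z t) \<le> K * z t powr (r + 1)" if "0 \<le> t" "t < T" for t
  proof -
    have zt: "z t \<ge> N" using z_N that by simp
    have "f (z t) = z t powr p * ln (z t) powr q" using zt N by (simp add: f_def)
    also have "\<dots> \<le> z t powr p * (ln N powr q * (z t / N) powr e)"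
      using zt assms by (intro mult_left_mono ln_powr_le) auto
    also have "\<dots> = K * z t powr (r + 1)"
      using zt N by (simp add: K_def r_def powr_divide powr_minus powr_add field_simps)
    finally show ?thesis .
  qed
  have f_cont: "continuous_on {a..} f"
    unfolding f_def using assms by (auto intro!: continuous_intros)
  have f_mono: "f s \<le> f s'" if "a \<le> s" "s \<le> s'" for s s'
    unfolding f_def using that assms by (intro mult_mono powr_mono2) auto
  have aN: "a \<le> N" using u0 infinite_verts by (metis finite.emptyI equals0I order_trans)
  have z0: "z 0 = N" using N r by (simp add: z_def powr_powr)
  have "\<exists>u. \<forall>x\<in>verts G. \<forall>t. 0 \<le> t \<and> t < T \<longrightarrow>
           a \<le> u x t \<and> u x t \<le> z t \<and> u x t = duhamel G f u0 u x t \<and> continuous_on {0..t} (u x)"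
  proof (rule monotone_iteration[OF f_cont f_mono _ _ _ z_deriv z_super])
    show "0 \<le> a" "0 \<le> f a" using assms(4) by (auto simp: f_def)
    show "a \<le> z t" if "0 \<le> t" "t < T" for t using z_N[OF that] aN by simp
    show "a \<le> u0 x \<and> u0 x \<le> z 0" if "x \<in> verts G" for x using u0[OF that] z0 by simp
  qed auto
  then obtain u where "\<forall>x\<in>verts G. \<forall>t. 0 \<le> t \<and> t < T \<longrightarrow>
           a \<le> u x t \<and> u x t \<le> z t \<and> u x t = duhamel G f u0 u x t \<and> continuous_on {0..t} (u x)"
    by blast
  then have "positive_solution G p q u0 (ereal T) u"
    unfolding f_def
    using assms(1,4) T DERIV_isCont[OF z_deriv]
    by (intro solution_of_duhamel_fixpoint[where a = a and z = z]) (meson | simp)+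
  then show ?thesis
    unfolding lifespan_def T_def r_def using T
    by (intro Sup_upper) (auto simp: T_def r_def)
qed

section \<open>Blow-up at a single vertex and the upper bound on the lifespan\<close>

text \<open>With \<open>w t = exp (D * t) * u x t\<close>, neglecting the neighbours gives \<open>w' \<ge> 0\<close>, so \<open>u x\<close> stays
  above \<open>exp (- D * \<tau>) * u0 x\<close> up to time \<open>\<tau>\<close>; this freezes the logarithm and leaves
  \<open>w' \<ge> c * w powr p\<close>.\<close>
lemma solution_time_le:
  assumes sol: "positive_solution G p q u0 T u"
    and p: "p > 1" and q: "q \<ge> 0" and x: "x \<in> verts G"
    and D: "weighted_degree G x \<le> D" and D0: "D \<ge> 0"
    and u0: "ln (u0 x) > D * \<tau>" "u0 x > 0"
    and B: "B = u0 x powr (1 - p) * exp ((p - 1) * D * \<tau>) / ((p - 1) * (ln (u0 x) - D * \<tau>) powr q)"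
    and small: "B < \<tau>"
  shows "T \<le> ereal B"
proof (rule ccontr)
  assume "\<not> T \<le> ereal B"
  \<comment> \<open>A solution living beyond \<open>B\<close> leaves room for a time
    \<open>t1\<close> above \<open>B\<close> and below both \<open>T\<close> and
    \<open>\<tau>\<close>: before \<open>T\<close> the equation holds, before \<open>\<tau>\<close>
    the lower bound on the logarithm holds.\<close>
  then have "ereal B < min T (ereal \<tau>)" using small by simp
  then obtain t1 where t1: "ereal B < ereal t1" "ereal t1 < min T (ereal \<tau>)"
    using ereal_dense2 by blast
  have B0: "B > 0" using p u0 by (auto simp: B)
  have t1': "B < t1" "ereal t1 < T" "t1 < \<tau>" "0 < t1" using t1 B0 by auto
  have lt: "ereal t < T" if "t \<le> t1" for t
    using that t1'(2) by (meson ereal_less_eq(3) le_less_trans)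
  define L where "L = (ln (u0 x) - D * \<tau>) powr q"
  define w where "w t = exp (D * t) * u x t" for t
  have pos: "u y t > 0" if "0 < t" "t \<le> t1" "y \<in> verts G" for y t
    using sol that lt unfolding positive_solution_def by blast
  have ux0: "u x 0 = u0 x" using sol x unfolding positive_solution_def by blast
  have posx: "u x t > 0" if "0 \<le> t" "t \<le> t1" for t
    using pos[of t x] ux0 u0 that x by (cases "t = 0") auto
  have u_cont: "continuous_on {0..t1} (u x)"
    using sol x lt unfolding positive_solution_def
    by (metis (mono_tags, lifting) atLeastAtMost_iff continuous_on_subset mem_Collect_eq subsetI)
  have u_deriv: "(u x has_real_derivative deriv (u x) t) (at t)" if "0 < t" "t \<le> t1" for t
  proof -
    have "u x C1_differentiable_on {t. 0 < t \<and> ereal t < T}"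
      using sol x unfolding positive_solution_def by blast
    then have "u x differentiable (at t)"
      using that lt by (simp add: C1_differentiable_on_eq)
    then show ?thesis
      by (simp add: DERIV_deriv_iff_real_differentiable)
  qed
  have deriv_ge: "u x t powr p * \<bar>ln (u x t)\<bar> powr q \<le> deriv (u x) t + D * u x t"
    if "0 < t" "t \<le> t1" for t
  proof -
    have "deriv (u x) t - laplacian G (\<lambda>y. u y t) x = u x t powr p * \<bar>ln (u x t)\<bar> powr q"
      using sol x that lt unfolding positive_solution_def by blast
    moreover have "0 \<le> (\<Sum>y\<in>nbrs G x. weight G x y * u y t) / vmeasure G x"
      using average_mono[OF x, of "\<lambda>_. 0" "\<lambda>y. u y t"] pos[OF that] by (auto intro: less_imp_le)
    moreover have "weighted_degree G x * u x t \<le> D * u x t"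
      using D posx[of t] that by (intro mult_right_mono) auto
    ultimately show ?thesis unfolding laplacian_eq by linarith
  qed
  define w' where "w' t = exp (D * t) * (deriv (u x) t + D * u x t)" for t
  have w_deriv: "(w has_real_derivative w' t) (at t)" if "0 < t" "t \<le> t1" for t
    unfolding w_def[abs_def] w'_def using u_deriv[OF that]
    by (auto intro!: derivative_eq_intros simp: algebra_simps)
  have w_cont: "continuous_on {0..t1} w"
    unfolding w_def by (intro continuous_intros u_cont)
  have w_pos: "w t > 0" if "0 \<le> t" "t \<le> t1" for t
    using posx that by (simp add: w_def)
  have w_ge: "u0 x \<le> w t" if "0 \<le> t" "t \<le> t1" for t
  proof -
    have "w 0 \<le> w t"
    proof (rule DERIV_nonneg_imp_increasing_open[where f = w])
      show "0 \<le> t" by fact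
      show "continuous_on {0..t} w" by (rule continuous_on_subset[OF w_cont]) (use that in auto)
      fix s assume s: "0 < s" "s < t"
      then have "w' s \<ge> 0"
        using deriv_ge[of s] that unfolding w'_def
        by (smt (verit) exp_ge_zero mult_nonneg_nonneg powr_ge_zero)
      then show "\<exists>y. (w has_real_derivative y) (at s) \<and> 0 \<le> y" using w_deriv[of s] s that by auto
    qed
    then show ?thesis by (simp add: w_def ux0)
  qed
  have w'_ge: "exp (- ((p - 1) * D * \<tau>)) * L * w t powr p \<le> w' t" if "0 < t" "t \<le> t1" for t
  proof -
    have u_w: "u x t = exp (- D * t) * w t" by (simp add: w_def flip: exp_add mult.assoc)
    have "ln (u x t) = ln (w t) - D * t"
      using w_pos[of t] that by (simp add: u_w ln_mult)
    also have "\<dots> \<ge> ln (u0 x) - D * \<tau>"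
    proof -
      have "D * t \<le> D * \<tau>" using D0 that t1' by (intro mult_left_mono) auto
      moreover have "ln (u0 x) \<le> ln (w t)" using w_ge[of t] u0 that by simp
      ultimately show ?thesis by simp
    qed
    finally have "L \<le> \<bar>ln (u x t)\<bar> powr q"
      unfolding L_def using u0 q by (intro powr_mono2) auto
    then have "exp (D * t) * (u x t powr p * L) \<le> exp (D * t) * (u x t powr p * \<bar>ln (u x t)\<bar> powr q)"
      by (intro mult_left_mono) auto
    also have "\<dots> \<le> w' t"
      unfolding w'_def using deriv_ge[OF that] by (intro mult_left_mono) auto
    finally have 1: "exp (D * t) * (u x t powr p * L) \<le> w' t" .
    \<comment> \<open>Rewriting \<open>u\<close> through \<open>w\<close> leaves the factor
      \<open>exp (- ((p - 1) * D * t))\<close>, which is then bounded below by its value at the end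
      \<open>\<tau>\<close> of the window.\<close>
    have "u x t powr p = exp (- D * t * p) * w t powr p"
      using w_pos[of t] that by (simp add: u_w powr_mult exp_powr_real)
    then have "exp (D * t) * (u x t powr p * L) = (exp (D * t) * exp (- D * t * p)) * (L * w t powr p)"
      by simp
    also have "exp (D * t) * exp (- D * t * p) = exp (- ((p - 1) * D * t))"
      by (simp add: algebra_simps flip: exp_add)
    finally have 2: "exp (D * t) * (u x t powr p * L) = exp (- ((p - 1) * D * t)) * (L * w t powr p)" .
    have "(p - 1) * D * t \<le> (p - 1) * D * \<tau>"
      using D0 p that t1' by (intro mult_left_mono) auto
    then have "exp (- ((p - 1) * D * \<tau>)) * (L * w t powr p) \<le> exp (- ((p - 1) * D * t)) * (L * w t powr p)"
      by (intro mult_right_mono) (auto simp: L_def)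
    with 1 2 show ?thesis by (simp add: mult.assoc)
  qed
  \<comment> \<open>The function \<open>w powr (1 - p)\<close> starts at \<open>B * c\<close> and
    has derivative at most \<open>- c\<close>, so by the mean value theorem it would be negative at
    \<open>t1 > B\<close>, although \<open>w\<close> is positive there.\<close>
  define c where "c = (p - 1) * (exp (- ((p - 1) * D * \<tau>)) * L)"
  have c: "c > 0" using p u0 by (simp add: c_def L_def)
  have "\<exists>l s. 0 < s \<and> s < t1 \<and> ((\<lambda>t. w t powr (1 - p)) has_real_derivative l) (at s) \<and>
      w t1 powr (1 - p) - w 0 powr (1 - p) = (t1 - 0) * l"
  proof (rule MVT)
    show "continuous_on {0..t1} (\<lambda>t. w t powr (1 - p))"
      using w_cont w_pos by (force intro!: continuous_intros)
    show "(\<lambda>t. w t powr (1 - p)) differentiable (at s)" if "0 < s" "s < t1" for s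
      using w_deriv[of s] w_pos[of s] that
      by (auto intro!: derivative_eq_intros simp: real_differentiable_def)
  qed (use t1' in auto)
  then obtain l s where s: "0 < s" "s < t1"
    and l: "((\<lambda>t. w t powr (1 - p)) has_real_derivative l) (at s)"
    and eq: "w t1 powr (1 - p) - w 0 powr (1 - p) = t1 * l" by auto
  have "((\<lambda>t. w t powr (1 - p)) has_real_derivative (1 - p) * w s powr (1 - p - 1) * w' s) (at s)"
    using DERIV_fun_powr[OF w_deriv[of s] w_pos[of s], of "1 - p"] s by simp
  then have "l = - ((p - 1) * w s powr - p * w' s)"
    using DERIV_unique[OF l] by (simp add: algebra_simps)
  moreover have "c \<le> (p - 1) * w s powr - p * w' s"
  proof -
    have "(p - 1) * w s powr - p * (exp (- ((p - 1) * D * \<tau>)) * L * w s powr p) \<le>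
        (p - 1) * w s powr - p * w' s"
      using w'_ge[of s] s p by (intro mult_left_mono) auto
    moreover have "w s powr - p * w s powr p = 1"
      using w_pos[of s] s by (simp flip: powr_add)
    then have "(p - 1) * w s powr - p * (exp (- ((p - 1) * D * \<tau>)) * L * w s powr p) = c"
      unfolding c_def by algebra
    ultimately show ?thesis by simp
  qed
  ultimately have "c \<le> - l" by simp
  then have "t1 * c \<le> t1 * (- l)" using t1' by (intro mult_left_mono) auto
  then have "w t1 powr (1 - p) \<le> w 0 powr (1 - p) - t1 * c" using eq by simp
  moreover have "w t1 powr (1 - p) > 0" using w_pos[of t1] t1' by simp
  moreover have "w 0 powr (1 - p) = B * c"
  proof -
    have "w 0 = u0 x" by (simp add: w_def ux0)
    moreover have "exp ((p - 1) * D * \<tau>) * exp (- ((p - 1) * D * \<tau>)) = 1"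
      by (simp flip: exp_add)
    moreover have "L > 0" using u0 by (simp add: L_def)
    ultimately show ?thesis using p unfolding B c_def L_def[symmetric]
      by (simp add: field_simps flip: exp_add)
  qed
  moreover have "B * c < t1 * c" using t1' c by simp
  ultimately show False by linarith
qed

lemma lifespan_le:
  assumes "p > 1" "q \<ge> 0" "x \<in> verts G" "weighted_degree G x \<le> D" "D \<ge> 0"
    and "ln (u0 x) > D * \<tau>" "u0 x > 0"
    and "B = u0 x powr (1 - p) * exp ((p - 1) * D * \<tau>) / ((p - 1) * (ln (u0 x) - D * \<tau>) powr q)"
    and "B < \<tau>"
  shows "lifespan G p q u0 \<le> ereal B"
  unfolding lifespan_def using assms by (auto intro!: Sup_least solution_time_le)

text \<open>The window in \<open>solution_time_le\<close> is given length 1. The threshold is built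
  from \<open>p\<close>, \<open>q\<close> and the degree bound \<open>D\<close>, so it is common to
  all initial data.\<close>

lemma lifespan_finite:
  assumes "p > 1" "q \<ge> 0" "D_mu G < \<infinity>"
  shows "\<exists>C>1. \<forall>u0. (\<exists>x\<in>verts G. u0 x \<ge> C) \<longrightarrow> lifespan G p q u0 < \<infinity>"
proof -
  obtain D where D: "D \<ge> 0" "\<And>x. x \<in> verts G \<Longrightarrow> weighted_degree G x \<le> D"
    using weighted_degree_bounded[OF assms(3)] by blast
  obtain C0 where C0: "\<And>y. y \<ge> C0 \<Longrightarrow> y > 1 \<and> ln y > D * 1 \<and>
      y powr (1 - p) * exp ((p - 1) * D * 1) / ((p - 1) * (ln y - D * 1) powr q) < 1"
    using eventually_lifespan_bound_small[of p q 1 D] assms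
    unfolding eventually_at_top_linorder by auto
  have "lifespan G p q u0 < \<infinity>" if "x \<in> verts G" "u0 x \<ge> max C0 2" for u0 x
  proof -
    have "u0 x \<ge> C0" using that by simp
    from C0[OF this] have "lifespan G p q u0 \<le>
        ereal (u0 x powr (1 - p) * exp ((p - 1) * D * 1) / ((p - 1) * (ln (u0 x) - D * 1) powr q))"
      using assms D that by (intro lifespan_le[where x = x and D = D and \<tau> = 1]) auto
    then show ?thesis by (rule le_less_trans) simp
  qed
  then show ?thesis by (intro exI[of _ "max C0 2"]) auto
qed

section \<open>Asymptotics of the normalized lifespan for large data\<close>

lemma sup_norm_bounds:
  assumes "\<And>x. x \<in> verts G \<Longrightarrow> \<psi> x \<ge> 0" "bounded (\<psi> ` verts G)" "(INF x\<in>verts G. \<psi> x) > 0"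
  shows "x \<in> verts G \<Longrightarrow> (INF x\<in>verts G. \<psi> x) \<le> \<psi> x" "x \<in> verts G \<Longrightarrow> \<psi> x \<le> sup_norm G \<psi>"
    and "sup_norm G \<psi> > 0"
    and "c < sup_norm G \<psi> \<Longrightarrow> \<exists>x\<in>verts G. c < \<psi> x"
proof -
  have ne: "verts G \<noteq> {}" using infinite_verts by auto
  have eq: "sup_norm G \<psi> = (SUP x\<in>verts G. \<psi> x)"
    unfolding sup_norm_def using assms(1) by (intro SUP_cong) auto
  show 1: "(INF x\<in>verts G. \<psi> x) \<le> \<psi> x" if "x \<in> verts G" for x
    using that assms(2) by (intro cINF_lower bounded_imp_bdd_below)
  show 2: "\<psi> x \<le> sup_norm G \<psi>" if "x \<in> verts G" for x
    unfolding eq using that assms(2) by (intro cSUP_upper bounded_imp_bdd_above)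
  show "sup_norm G \<psi> > 0"
    using ne 1 2 assms(3) by (meson ex_in_conv less_le_trans)
  show "\<exists>x\<in>verts G. c < \<psi> x" if "c < sup_norm G \<psi>"
    using that less_cSUP_iff[OF ne bounded_imp_bdd_above[OF assms(2)]] unfolding eq by blast
qed

text \<open>In \<open>lifespan_ge\<close> the lower barrier is \<open>l\<close> times the infimum
  and \<open>N\<close> is \<open>l\<close> times the supremum; the normalizing factor then cancels
  and only the loss \<open>e\<close> remains.\<close>

lemma eventually_normalized_lifespan_ge:
  assumes "p > 1" "q > 0" "e > 0"
    and \<psi>: "\<And>x. x \<in> verts G \<Longrightarrow> \<psi> x \<ge> 0" "bounded (\<psi> ` verts G)" "(INF x\<in>verts G. \<psi> x) > 0"
  shows "eventually (\<lambda>l. ereal (1 / (p - 1 + e)) \<le>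
    ereal ((l * sup_norm G \<psi>) powr (p - 1) * ln (l * sup_norm G \<psi>) powr q)
      * lifespan G p q (\<lambda>x. l * \<psi> x)) at_top"
proof -
  let ?M = "sup_norm G \<psi>" and ?m = "INF x\<in>verts G. \<psi> x"
  note b = sup_norm_bounds[OF \<psi>]
  have "eventually (\<lambda>l. l > 0 \<and> l > 1 / ?m \<and> l > max 1 (exp (q / e)) / ?M) at_top"
    by (intro eventually_conj eventually_gt_at_top)
  then show ?thesis
  proof eventually_elim
    case (elim l)
    let ?N = "l * ?M"
    have N: "?N > exp (q / e)" "?N > 1" and a: "l * ?m > 1"
      using elim b(3) \<psi>(3) by (auto simp: field_simps)
    have c: "?N powr (p - 1) * ln ?N powr q > 0"
      using N by (intro mult_pos_pos) auto
    have "ereal (1 / ((p - 1 + e) * (?N powr (p - 1) * ln ?N powr q)))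
        \<le> lifespan G p q (\<lambda>x. l * \<psi> x)"
      using assms(1-3) N a elim b(1,2) by (intro lifespan_ge[where a = "l * ?m"]) auto
    then have "ereal (?N powr (p - 1) * ln ?N powr q) *
        ereal (1 / ((p - 1 + e) * (?N powr (p - 1) * ln ?N powr q)))
      \<le> ereal (?N powr (p - 1) * ln ?N powr q) * lifespan G p q (\<lambda>x. l * \<psi> x)"
      using c by (intro ereal_mult_left_mono) auto
    moreover have "(?N powr (p - 1) * ln ?N powr q) *
        (1 / ((p - 1 + e) * (?N powr (p - 1) * ln ?N powr q))) = 1 / (p - 1 + e)"
    proof -
      have "c * (1 / ((p - 1 + e) * c)) = 1 / (p - 1 + e)" if "c > 0" for c :: real
        using that by simp
      then show ?thesis using c by blast
    qed
    ultimately show ?case by simp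
  qed
qed

text \<open>The supremum of \<open>\<psi>\<close> need not be attained, so a vertex is fixed where
  \<open>\<psi>\<close> exceeds \<open>exp (- \<theta>)\<close> times it, and the same
  \<open>\<theta>\<close> is the time window. The two losses combine to
  \<open>exp ((p - 1) * (1 + D) * \<theta>)\<close>, which tends to 1 as \<open>\<theta>\<close>
  tends to 0.\<close>

lemma eventually_normalized_lifespan_le:
  assumes "p > 1" "q \<ge> 0" "D_mu G < \<infinity>" "b > 1 / (p - 1)"
    and \<psi>: "\<And>x. x \<in> verts G \<Longrightarrow> \<psi> x \<ge> 0" "bounded (\<psi> ` verts G)" "(INF x\<in>verts G. \<psi> x) > 0"
  shows "eventually (\<lambda>l.
    ereal ((l * sup_norm G \<psi>) powr (p - 1) * ln (l * sup_norm G \<psi>) powr q)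
      * lifespan G p q (\<lambda>x. l * \<psi> x) < ereal b) at_top"
proof -
  let ?M = "sup_norm G \<psi>"
  note bd = sup_norm_bounds[OF \<psi>]
  obtain D where D: "D \<ge> 0" "\<And>x. x \<in> verts G \<Longrightarrow> weighted_degree G x \<le> D"
    using weighted_degree_bounded[OF assms(3)] by blast
  have "((\<lambda>\<theta>. exp ((p - 1) * (1 + D) * \<theta>) / (p - 1)) \<longlongrightarrow> exp ((p - 1) * (1 + D) * 0) / (p - 1))
      (at_right 0)"
    using assms(1) by (intro tendsto_intros) auto
  then have "eventually (\<lambda>\<theta>. exp ((p - 1) * (1 + D) * \<theta>) / (p - 1) < b) (at_right 0)"
    using assms(4) by (intro order_tendstoD) auto
  then have "eventually (\<lambda>\<theta>. \<theta> > 0 \<and> exp ((p - 1) * (1 + D) * \<theta>) / (p - 1) < b) (at_right 0)"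
    by (intro eventually_conj eventually_at_right_less)
  then obtain \<theta> :: real where \<theta>: "\<theta> > 0" "exp ((p - 1) * (1 + D) * \<theta>) / (p - 1) < b"
    using eventually_happens trivial_limit_at_right_real by blast
  have "exp (- \<theta>) * ?M < ?M" using \<theta> bd(3) by simp
  then obtain x where x: "x \<in> verts G" "exp (- \<theta>) * ?M < \<psi> x" using bd(4) by blast
  define m where "m = \<psi> x"
  have m: "m > 0" using x bd(3) unfolding m_def by (meson exp_gt_zero less_trans mult_pos_pos)
  have "?M / m < exp \<theta>" using x m by (simp add: m_def[symmetric] exp_minus field_simps)
  then have "(?M / m) powr (p - 1) \<le> exp \<theta> powr (p - 1)"
    using bd(3) m assms(1) by (intro powr_mono2) auto
  then have "(?M / m) powr (p - 1) \<le> exp ((p - 1) * \<theta>)" by (simp add: exp_powr_real mult.commute)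
  then have "(?M / m) powr (p - 1) * exp ((p - 1) * D * \<theta>) / (p - 1) \<le>
      exp ((p - 1) * \<theta>) * exp ((p - 1) * D * \<theta>) / (p - 1)"
    using assms(1) by (intro divide_right_mono mult_right_mono) auto
  also have "\<dots> = exp ((p - 1) * (1 + D) * \<theta>) / (p - 1)"
    by (simp add: algebra_simps flip: exp_add)
  finally have lt_b: "(?M / m) powr (p - 1) * exp ((p - 1) * D * \<theta>) / (p - 1) < b" using \<theta> by simp
  have lm: "filterlim (\<lambda>l. l * m) at_top at_top"
    using filterlim_tendsto_pos_mult_at_top[OF tendsto_const m filterlim_ident]
    by (simp add: mult.commute)
  \<comment> \<open>\<open>B l\<close> is the blow-up bound at the fixed vertex \<open>x\<close>.
    \<open>R l\<close> is its product with the normalizing factor, arranged so that \<open>l\<close>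
    enters only through a quotient of logarithms.\<close>
  define B where "B l = (l * m) powr (1 - p) * exp ((p - 1) * D * \<theta>) /
      ((p - 1) * (ln (l * m) - D * \<theta>) powr q)" for l
  define R where "R l = (?M / m) powr (p - 1) * exp ((p - 1) * D * \<theta>) / (p - 1)
      * (ln (l * ?M) / (ln (l * m) - D * \<theta>)) powr q" for l
  \<comment> \<open>Numerator and denominator differ from \<open>ln l\<close> by constants, so the
    quotient is 1 plus a constant over a divergent term.\<close>
  have "((\<lambda>l. ln (l * ?M) / (ln (l * m) - D * \<theta>)) \<longlongrightarrow> 1) at_top"
  proof -
    have "filterlim (\<lambda>l. ln l + (ln m - D * \<theta>)) at_infinity at_top"
      using filterlim_tendsto_add_at_top[OF tendsto_const ln_at_top, of "ln m - D * \<theta>"]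
      by (simp add: add.commute filterlim_at_top_imp_at_infinity)
    then have "((\<lambda>l. 1 + (ln ?M - (ln m - D * \<theta>)) / (ln l + (ln m - D * \<theta>))) \<longlongrightarrow> 1 + 0) at_top"
      by (intro tendsto_add tendsto_const tendsto_divide_0[OF tendsto_const])
    moreover have "eventually (\<lambda>l. ln l + (ln m - D * \<theta>) > 0) at_top"
      using eventually_compose_filterlim[OF eventually_gt_at_top ln_at_top, of "- (ln m - D * \<theta>)"]
      by (rule eventually_mono) simp
    then have "eventually (\<lambda>l. 1 + (ln ?M - (ln m - D * \<theta>)) / (ln l + (ln m - D * \<theta>)) =
        ln (l * ?M) / (ln (l * m) - D * \<theta>)) at_top"
      using eventually_gt_at_top[of 0]
      by eventually_elim (use bd(3) m in \<open>simp add: ln_mult field_simps\<close>)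
    ultimately show ?thesis
      using Lim_transform_eventually by fastforce
  qed
  then have "(R \<longlongrightarrow> (?M / m) powr (p - 1) * exp ((p - 1) * D * \<theta>) / (p - 1) * 1 powr q) at_top"
    unfolding R_def by (intro tendsto_intros) auto
  then have "eventually (\<lambda>l. R l < b) at_top"
    using lt_b by (intro order_tendstoD) auto
  moreover have "eventually (\<lambda>l. l > 0 \<and> l > 1 / ?M) at_top"
    by (intro eventually_conj eventually_gt_at_top)
  moreover have "eventually (\<lambda>l. l * m > 1 \<and> ln (l * m) > D * \<theta> \<and> B l < \<theta>) at_top"
    using eventually_compose_filterlim[OF eventually_lifespan_bound_small lm] assms(1,2) \<theta>(1)
    unfolding B_def by blast
  ultimately show ?thesis
  proof eventually_elim
    case (elim l)
    let ?c = "(l * ?M) powr (p - 1) * ln (l * ?M) powr q"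
    have lM: "l * ?M > 1" using elim bd(3) by (simp add: field_simps)
    have "lifespan G p q (\<lambda>x. l * \<psi> x) \<le> ereal (B l)"
      using assms(1,2) x D elim
      by (intro lifespan_le[where x = x and D = D and \<tau> = \<theta>]) (auto simp: B_def m_def)
    then have "ereal ?c * lifespan G p q (\<lambda>x. l * \<psi> x) \<le> ereal ?c * ereal (B l)"
      by (intro ereal_mult_left_mono) auto
    also have "?c * B l = R l"
    proof -
      have "(l * ?M) powr (p - 1) * (l * m) powr (1 - p) = (l * ?M) powr (p - 1) / (l * m) powr (p - 1)"
        by (simp add: divide_inverse flip: powr_minus)
      also have "\<dots> = (?M / m) powr (p - 1)"
        using elim bd(3) m by (simp flip: powr_divide)
      finally have "(?M / m) powr (p - 1) = (l * ?M) powr (p - 1) * (l * m) powr (1 - p)" ..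
      moreover have "(ln (l * ?M) / (ln (l * m) - D * \<theta>)) powr q =
          ln (l * ?M) powr q / (ln (l * m) - D * \<theta>) powr q"
        by (rule powr_divide)
      ultimately show ?thesis by (simp add: B_def R_def mult_ac)
    qed
    then have "ereal ?c * ereal (B l) < ereal b" using elim by simp
    finally show ?case .
  qed
qed

end

section \<open>Finiteness for large data and the limit of the normalized lifespan\<close>

theorem theorem1p5:
  fixes G :: "'v wgraph" and p q :: real
  assumes "weighted_graph G"
    and "D_mu G < \<infinity>"
    and "p > 1" and "q \<ge> 1"
  shows "\<exists>C>0. \<forall>\<psi> :: 'v \<Rightarrow> real.
    (\<forall>x\<in>verts G. \<psi> x \<ge> 0) \<and> bounded (\<psi> ` verts G) \<and> (\<exists>x\<in>verts G. \<psi> x \<noteq> 0) \<and>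
    (INF x\<in>verts G. \<psi> x) > 0 \<longrightarrow>
      (\<forall>l T u \<Omega> \<phi> \<Lambda>.
         l > 0 \<and>
         T > 0 \<and> positive_solution G p q (\<lambda>x. l * \<psi> x) T u \<and>
         \<Omega> \<subseteq> verts G \<and> \<Omega> \<noteq> {} \<and> finite \<Omega> \<and> connected_in G \<Omega> \<and>
         normalized_first_eigenfunction G \<Omega> \<phi> \<and>
         graph_integral G \<Omega> (\<lambda>x. u x 0 * \<phi> x) \<ge> 1 \<and>
         \<Lambda> > 0 \<and> \<Lambda> * (INF x\<in>verts G. \<psi> x) \<ge> max C 1 \<and> l > \<Lambda>
         \<longrightarrow> lifespan G p q (\<lambda>x. l * \<psi> x) < \<infinity>) \<and>
      ((\<lambda>l. ereal ((l * sup_norm G \<psi>) powr (p - 1) * ln (l * sup_norm G \<psi>) powr q)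
             * lifespan G p q (\<lambda>x. l * \<psi> x)) \<longlongrightarrow> ereal (1 / (p - 1))) at_top"
proof -
  interpret weighted_graph G by fact
  have q: "q > 0" using assms(4) by simp
  obtain C where C: "C > 1"
    "\<And>u0. \<exists>x\<in>verts G. u0 x \<ge> C \<Longrightarrow> lifespan G p q u0 < \<infinity>"
    using lifespan_finite[OF assms(3) _ assms(2), of q] q by auto
  show ?thesis
  proof (intro exI[of _ C] conjI allI impI; (elim conjE)?)
    show "C > 0" using C by simp
  next
    fix \<psi> :: "'v \<Rightarrow> real" and l \<Lambda> :: real
    assume \<psi>: "\<forall>x\<in>verts G. \<psi> x \<ge> 0" "bounded (\<psi> ` verts G)" "(INF x\<in>verts G. \<psi> x) > 0"
      and \<Lambda>: "\<Lambda> * (INF x\<in>verts G. \<psi> x) \<ge> max C 1" "\<Lambda> > 0" "l > \<Lambda>"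
    \<comment> \<open>A large datum at one vertex suffices, and any vertex will do because the
      infimum bounds \<open>\<psi>\<close> from below everywhere.\<close>
    obtain x where x: "x \<in> verts G" using infinite_verts by (metis equals0I finite.emptyI)
    have "C \<le> \<Lambda> * (INF x\<in>verts G. \<psi> x)" using \<Lambda> by simp
    also have "\<dots> \<le> l * \<psi> x"
      using sup_norm_bounds(1)[OF _ \<psi>(2,3) x] \<psi> \<Lambda> by (intro mult_mono) auto
    finally show "lifespan G p q (\<lambda>x. l * \<psi> x) < \<infinity>" using C(2)[of "\<lambda>x. l * \<psi> x"] x by blast
  next
    fix \<psi> :: "'v \<Rightarrow> real"
    assume \<psi>: "\<forall>x\<in>verts G. \<psi> x \<ge> 0" "bounded (\<psi> ` verts G)" "(INF x\<in>verts G. \<psi> x) > 0"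
    let ?F = "\<lambda>l. ereal ((l * sup_norm G \<psi>) powr (p - 1) * ln (l * sup_norm G \<psi>) powr q)
             * lifespan G p q (\<lambda>x. l * \<psi> x)"
    show "(?F \<longlongrightarrow> ereal (1 / (p - 1))) at_top"
    proof (rule order_tendstoI)
      fix a assume "a < ereal (1 / (p - 1))"
      then obtain r where r: "a < ereal r" "r < 1 / (p - 1)"
        using ereal_dense2 by force
      \<comment> \<open>The loss \<open>e\<close> is chosen so small that
        \<open>1 / (p - 1 + e)\<close> still exceeds the real number \<open>r\<close> placed between
        \<open>a\<close> and the limit.\<close>
      have "((\<lambda>e. 1 / (p - 1 + e)) \<longlongrightarrow> 1 / (p - 1 + 0)) (at_right 0)"
        using assms(3) by (intro tendsto_intros) auto
      then have "eventually (\<lambda>e. r < 1 / (p - 1 + e)) (at_right 0)"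
        using r by (intro order_tendstoD) auto
      then have "eventually (\<lambda>e. e > 0 \<and> r < 1 / (p - 1 + e)) (at_right 0)"
        by (intro eventually_conj eventually_at_right_less)
      then obtain e :: real where e: "e > 0" "r < 1 / (p - 1 + e)"
        using eventually_happens trivial_limit_at_right_real by blast
      have "eventually (\<lambda>l. ereal (1 / (p - 1 + e)) \<le> ?F l) at_top"
        using eventually_normalized_lifespan_ge[OF assms(3) q e(1)] \<psi> by blast
      then show "eventually (\<lambda>l. a < ?F l) at_top"
      proof eventually_elim
        case (elim l)
        have "a < ereal (1 / (p - 1 + e))"
          using r(1) e(2) by (meson ereal_less_eq(3) less_le_trans less_imp_le)
        then show ?case using elim by (rule less_le_trans)
      qed
    next
      fix a assume "ereal (1 / (p - 1)) < a"
      then obtain r where r: "ereal r < a" "1 / (p - 1) < r"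
        using ereal_dense2 by force
      have "eventually (\<lambda>l. ?F l < ereal r) at_top"
        using eventually_normalized_lifespan_le[OF assms(3) _ assms(2) r(2)] q \<psi> by auto
      then show "eventually (\<lambda>l. ?F l < a) at_top"
        by eventually_elim (use r in \<open>metis less_trans\<close>)
    qed
  qed
qed

end
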